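(* Let $X$ be a $T_0$ space. (1) Suppose that $X$ is well-filtered. If the Smyth power space $P^s(X)$ is quasisober, then $X$ is quasisober. (2) Suppose that $X$ with its specialization order is a sup semilattice. If $P^s(X)$ is quasisober, then $X$ is quasisober.
   Context: For a topological space $X$, the specialization preorder is $x\le y$ iff $x\in\mathrm{cl}\{y\}$; all order-theoretic notions in $X$ refer to it. For $A\subseteq X$, $A^{\uparrow}$ and $A^{\downarrow}$ denote the sets of all upper, respectively lower, bounds of $A$ in $X$, and $A^{\delta}=(A^{\uparrow})^{\downarrow}$ is the cut closure of $A$. Directed sets and irreducible closed sets are nonempty. $X$ is quasisober if it is $T_0$ and every irreducible closed subset of $X$ equals $D^{\delta}$ for some directed subset $D$ of $X$. A subset is saturated if it is an intersection of open sets, equivalently an upper set. $X$ is well-filtered if for every filter basis $\mathcal{C}$ of compact saturated sets (a nonempty family, directed under reverse inclusion) and every open $U$ with $\bigcap\mathcal{C}\subseteq U$, there is $K\in\mathcal{C}$ with $K\subseteq U$. A sup semilattice is a poset in which any two elements have a least upper bound. The Smyth power space $P^s(X)$ is the set $K(X)$ of nonempty compact saturated subsets of $X$, with the upper Vietoris topology generated by the sets $\Box U=\{K\in K(X):K\subseteq U\}$, $U$ open in $X$; its specialization order is reverse inclusion. *)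

theory Defs
  imports "HOL-Analysis.Analysis"
begin

definition specialization :: "'a topology \<Rightarrow> ('a \<times> 'a) set" where
  "specialization X = {(x, y). y \<in> topspace X \<and> x \<in> X closure_of {y}}"

(* Above and Under from HOL.Order_Relation range over the field of the relation;
   by this lemma they are therefore the sets of upper and lower bounds in X. *)
lemma Field_specialization: "Field (specialization X) = topspace X"
  by (fastforce simp: specialization_def Field_def in_closure_of)

lemma preorder_on_specialization: "preorder_on (topspace X) (specialization X)"
  unfolding preorder_on_def refl_on_def trans_def
  by (auto simp: specialization_def in_closure_of)

lemma specialization_iff_open:
  "(x, y) \<in> specialization X \<longleftrightarrow>
     x \<in> topspace X \<and> y \<in> topspace X \<and> (\<forall>U. openin X U \<longrightarrow> x \<in> U \<longrightarrow> y \<in> U)"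
  by (auto simp: specialization_def in_closure_of)

definition cut_closure :: "'a topology \<Rightarrow> 'a set \<Rightarrow> 'a set" where
  "cut_closure X A = Under (specialization X) (Above (specialization X) A)"

definition directedin :: "'a topology \<Rightarrow> 'a set \<Rightarrow> bool" where
  "directedin X D \<longleftrightarrow>
     D \<noteq> {} \<and> D \<subseteq> topspace X \<and>
     (\<forall>x\<in>D. \<forall>y\<in>D. \<exists>z\<in>D. (x, z) \<in> specialization X \<and> (y, z) \<in> specialization X)"

definition irreducible_closedin :: "'a topology \<Rightarrow> 'a set \<Rightarrow> bool" where
  "irreducible_closedin X A \<longleftrightarrow>
     closedin X A \<and> A \<noteq> {} \<and>
     (\<forall>B C. closedin X B \<longrightarrow> closedin X C \<longrightarrow> A \<subseteq> B \<union> C \<longrightarrow> A \<subseteq> B \<or> A \<subseteq> C)"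

definition quasisober :: "'a topology \<Rightarrow> bool" where
  "quasisober X \<longleftrightarrow>
     t0_space X \<and>
     (\<forall>A. irreducible_closedin X A \<longrightarrow> (\<exists>D. directedin X D \<and> A = cut_closure X D))"

(* Restricting to nonempty families loses nothing: the whole space is itself open. *)
definition saturatedin :: "'a topology \<Rightarrow> 'a set \<Rightarrow> bool" where
  "saturatedin X S \<longleftrightarrow> (\<exists>\<U>. \<U> \<noteq> {} \<and> (\<forall>U\<in>\<U>. openin X U) \<and> S = \<Inter>\<U>)"

lemma saturatedin_iff_upper:
  "saturatedin X S \<longleftrightarrow>
     S \<subseteq> topspace X \<and> (\<forall>x y. x \<in> S \<longrightarrow> (x, y) \<in> specialization X \<longrightarrow> y \<in> S)"
proof
  assume "saturatedin X S"
  then obtain \<U> where U: "\<U> \<noteq> {}" "\<forall>U\<in>\<U>. openin X U" "S = \<Inter>\<U>"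
    unfolding saturatedin_def by blast
  then show "S \<subseteq> topspace X \<and> (\<forall>x y. x \<in> S \<longrightarrow> (x, y) \<in> specialization X \<longrightarrow> y \<in> S)"
    using openin_subset unfolding specialization_iff_open by blast
next
  assume R: "S \<subseteq> topspace X \<and> (\<forall>x y. x \<in> S \<longrightarrow> (x, y) \<in> specialization X \<longrightarrow> y \<in> S)"
  define \<U> where "\<U> = insert (topspace X) {topspace X - X closure_of {y} |y. y \<in> topspace X - S}"
  have "S \<subseteq> \<Inter>\<U>"
    using R unfolding \<U>_def specialization_def by blast
  moreover have "\<Inter>\<U> \<subseteq> S"
  proof
    fix x assume x: "x \<in> \<Inter>\<U>"
    show "x \<in> S"
    proof (rule ccontr)
      assume "x \<notin> S"
      then have "x \<in> topspace X - X closure_of {x}"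
        using x unfolding \<U>_def by blast
      then show False by (simp add: in_closure_of)
    qed
  qed
  moreover have "\<forall>U\<in>\<U>. openin X U"
    unfolding \<U>_def by auto
  moreover have "\<U> \<noteq> {}"
    unfolding \<U>_def by simp
  ultimately show "saturatedin X S"
    unfolding saturatedin_def by blast
qed

definition well_filtered :: "'a topology \<Rightarrow> bool" where
  "well_filtered X \<longleftrightarrow>
     (\<forall>\<C> U. \<C> \<noteq> {} \<longrightarrow>
            (\<forall>K\<in>\<C>. compactin X K \<and> saturatedin X K) \<longrightarrow>
            (\<forall>K\<in>\<C>. \<forall>L\<in>\<C>. \<exists>M\<in>\<C>. M \<subseteq> K \<and> M \<subseteq> L) \<longrightarrow>
            openin X U \<longrightarrow> \<Inter>\<C> \<subseteq> U \<longrightarrow> (\<exists>K\<in>\<C>. K \<subseteq> U))"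

definition is_sup :: "('a \<times> 'a) set \<Rightarrow> 'a set \<Rightarrow> 'a \<Rightarrow> bool" where
  "is_sup r A s \<longleftrightarrow> s \<in> Above r A \<and> (\<forall>u\<in>Above r A. (s, u) \<in> r)"

definition sup_semilattice_on :: "'a set \<Rightarrow> ('a \<times> 'a) set \<Rightarrow> bool" where
  "sup_semilattice_on A r \<longleftrightarrow>
     partial_order_on A r \<and> (\<forall>x\<in>A. \<forall>y\<in>A. \<exists>s. is_sup r {x, y} s)"

definition compact_saturated_sets :: "'a topology \<Rightarrow> 'a set set" where
  "compact_saturated_sets X = {K. K \<noteq> {} \<and> compactin X K \<and> saturatedin X K}"

definition smyth_box :: "'a topology \<Rightarrow> 'a set \<Rightarrow> 'a set set" where
  "smyth_box X U = {K \<in> compact_saturated_sets X. K \<subseteq> U}"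

definition smyth_power_space :: "'a topology \<Rightarrow> 'a set topology" where
  "smyth_power_space X = topology_generated_by {smyth_box X U |U. openin X U}"

lemma topspace_smyth_power_space: "topspace (smyth_power_space X) = compact_saturated_sets X"
proof -
  have "smyth_box X (topspace X) = compact_saturated_sets X"
    using compactin_subset_topspace by (auto simp: smyth_box_def compact_saturated_sets_def)
  then show ?thesis
    unfolding smyth_power_space_def topology_generated_by_topspace
    by (auto simp: smyth_box_def)
qed

lemma openin_smyth_box: "openin X U \<Longrightarrow> openin (smyth_power_space X) (smyth_box X U)"
  unfolding smyth_power_space_def by (auto intro: topology_generated_by_Basis)

lemma specialization_smyth_power_space:
  "(K, L) \<in> specialization (smyth_power_space X) \<longleftrightarrow>
     K \<in> compact_saturated_sets X \<and> L \<in> compact_saturated_sets X \<and> L \<subseteq> K"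
proof
  assume R: "(K, L) \<in> specialization (smyth_power_space X)"
  then have KL: "K \<in> compact_saturated_sets X" "L \<in> compact_saturated_sets X"
    by (auto simp: specialization_iff_open topspace_smyth_power_space)
  obtain \<U> where U: "\<forall>U\<in>\<U>. openin X U" "K = \<Inter>\<U>"
    using KL(1) unfolding compact_saturated_sets_def saturatedin_def by blast
  have "L \<subseteq> U" if "U \<in> \<U>" for U
  proof -
    have "K \<in> smyth_box X U" using that U KL by (auto simp: smyth_box_def)
    then have "L \<in> smyth_box X U"
      using R openin_smyth_box U(1) that unfolding specialization_iff_open by blast
    then show ?thesis by (simp add: smyth_box_def)
  qed
  then show "K \<in> compact_saturated_sets X \<and> L \<in> compact_saturated_sets X \<and> L \<subseteq> K"
    using KL U by blast
next
  assume R: "K \<in> compact_saturated_sets X \<and> L \<in> compact_saturated_sets X \<and> L \<subseteq> K"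
  have "K \<in> W \<longrightarrow> L \<in> W"
    if "generate_topology_on {smyth_box X U |U. openin X U} W" for W
    using that by induction (use R in \<open>auto simp: smyth_box_def\<close>)
  then show "(K, L) \<in> specialization (smyth_power_space X)"
    using R unfolding specialization_iff_open topspace_smyth_power_space
    by (simp add: smyth_power_space_def openin_topology_generated_by_iff)
qed

end

(* For an irreducible closed set A of X, the compact saturated sets meeting A form an irreducible
   closed set of the Smyth power space, hence the cut closure of a filter basis \<D>.  Testing this on
   principal upper sets shows that A is the set of lower bounds of C = \<Inter>\<D>, while every member of \<D>
   meets A.  If X is well-filtered, then C meets A as well, and a common point is the greatest
   element of A.  If X is a sup semilattice, then A, being a set of lower bounds, is closed under
   binary suprema; so A is directed and equal to its own cut closure. *)

theory Submission
  imports Defs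
begin

lemma specialization_refl: "x \<in> topspace X \<Longrightarrow> (x, x) \<in> specialization X"
  by (simp add: specialization_iff_open)

lemma specialization_trans:
  "(x, y) \<in> specialization X \<Longrightarrow> (y, z) \<in> specialization X \<Longrightarrow> (x, z) \<in> specialization X"
  by (simp add: specialization_iff_open)

lemma closedin_specialization_lower:
  assumes "closedin X A" "y \<in> A" "(x, y) \<in> specialization X"
  shows "x \<in> A"
  using assms unfolding closedin_def specialization_iff_open by blast

lemma principal_upper_subset_open_iff:
  assumes "openin X U" "x \<in> topspace X"
  shows "specialization X `` {x} \<subseteq> U \<longleftrightarrow> x \<in> U"
  using assms specialization_refl[of x X] by (auto simp: specialization_iff_open)

lemma principal_upper_compact_saturated:
  assumes "x \<in> topspace X"
  shows "specialization X `` {x} \<in> compact_saturated_sets X"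
proof -
  let ?K = "specialization X `` {x}"
  have x: "x \<in> ?K"
    using assms specialization_refl by fast
  have sub: "?K \<subseteq> topspace X"
    by (auto simp: specialization_iff_open)
  have "compactin X ?K"
    unfolding compactin_def
  proof (intro conjI allI impI sub)
    fix \<U> assume U: "Ball \<U> (openin X) \<and> ?K \<subseteq> \<Union>\<U>"
    \<comment> \<open>A single member of the cover suffices: the one containing the least element
      \<open>x\<close>.\<close>
    then obtain U where "U \<in> \<U>" "x \<in> U" using x by blast
    then have "finite {U} \<and> {U} \<subseteq> \<U> \<and> ?K \<subseteq> \<Union>{U}"
      using U principal_upper_subset_open_iff[OF _ assms, of U] by simp
    then show "\<exists>\<F>. finite \<F> \<and> \<F> \<subseteq> \<U> \<and> ?K \<subseteq> \<Union>\<F>" by blast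
  qed
  moreover have "saturatedin X ?K"
    unfolding saturatedin_iff_upper using sub specialization_trans by fast
  ultimately show ?thesis
    using x unfolding compact_saturated_sets_def by blast
qed

lemma compact_saturated_principal_upper_subset:
  assumes "K \<in> compact_saturated_sets X" "x \<in> K"
  shows "specialization X `` {x} \<subseteq> K"
  using assms by (auto simp: compact_saturated_sets_def saturatedin_iff_upper)

text \<open>The preimage of \<open>smyth_box X U\<close> is \<open>U\<close> itself. Continuity
  serves to pull closed sets of the power space back to X, where irreducibility of A can be
  applied.\<close>

lemma continuous_map_principal_upper:
  "continuous_map X (smyth_power_space X) (\<lambda>x. specialization X `` {x})"
  unfolding smyth_power_space_def
proof (rule continuous_on_generated_topo)
  fix W assume "W \<in> {smyth_box X U |U. openin X U}"
  then obtain U where U: "openin X U" "W = smyth_box X U" by blast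
  have "(\<lambda>x. specialization X `` {x}) -` W \<inter> topspace X = U"
    using U openin_subset[OF U(1)] principal_upper_subset_open_iff[OF U(1)]
      principal_upper_compact_saturated[of _ X]
    by (auto simp: smyth_box_def)
  then show "openin X ((\<lambda>x. specialization X `` {x}) -` W \<inter> topspace X)"
    using U by simp
next
  show "(\<lambda>x. specialization X `` {x}) ` topspace X \<subseteq> \<Union>{smyth_box X U |U. openin X U}"
    using principal_upper_compact_saturated[of _ X] topspace_smyth_power_space[of X]
    unfolding smyth_power_space_def topology_generated_by_topspace by auto
qed

lemma irreducible_closedin_meeting:
  assumes "irreducible_closedin X A"
  shows "irreducible_closedin (smyth_power_space X) {K \<in> compact_saturated_sets X. K \<inter> A \<noteq> {}}"
    (is "irreducible_closedin ?P ?A")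
proof -
  let ?up = "\<lambda>x. specialization X `` {x}"
  have A: "closedin X A" "A \<noteq> {}" and
    irr: "\<And>B C. closedin X B \<Longrightarrow> closedin X C \<Longrightarrow> A \<subseteq> B \<union> C \<Longrightarrow> A \<subseteq> B \<or> A \<subseteq> C"
    using assms unfolding irreducible_closedin_def by blast+
  have AX: "A \<subseteq> topspace X" by (simp add: A(1) closedin_subset)
  have up: "?up a \<in> ?A" if "a \<in> A" for a
    using that AX principal_upper_compact_saturated specialization_refl by fast
  have "K \<subseteq> topspace X" if "K \<in> compact_saturated_sets X" for K
    using that by (simp add: compact_saturated_sets_def compactin_subset_topspace)
  \<comment> \<open>A compact saturated set misses A exactly when it lies in the open complement of
    A.\<close>
  then have "topspace ?P - ?A = smyth_box X (topspace X - A)"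
    unfolding topspace_smyth_power_space smyth_box_def by blast
  then have "closedin ?P ?A"
    using A(1) unfolding closedin_def topspace_smyth_power_space
    by (simp add: openin_smyth_box)
  moreover have "?A \<noteq> {}" using A(2) up by blast
  \<comment> \<open>Minimality: if K meets A in a, then K lies below \<open>?up a\<close> in the
    reverse inclusion order, and closed sets are lower sets.\<close>
  moreover have sub: "?A \<subseteq> B"
    if B: "closedin ?P B" "A \<subseteq> {x \<in> topspace X. ?up x \<in> B}" for B
  proof
    fix K assume K: "K \<in> ?A"
    then obtain a where a: "a \<in> K" "a \<in> A" by blast
    then have "(K, ?up a) \<in> specialization ?P"
      using K up[OF a(2)] compact_saturated_principal_upper_subset[OF _ a(1)]
      by (simp add: specialization_smyth_power_space)
    moreover have "?up a \<in> B" using B(2) a(2) by blast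
    ultimately show "K \<in> B" using closedin_specialization_lower[OF B(1)] by blast
  qed
  moreover have "?A \<subseteq> B \<or> ?A \<subseteq> C"
    if B: "closedin ?P B" and C: "closedin ?P C" and "?A \<subseteq> B \<union> C" for B C
  proof -
    have "A \<subseteq> {x \<in> topspace X. ?up x \<in> B} \<union> {x \<in> topspace X. ?up x \<in> C}"
      using that AX up by blast
    then have "A \<subseteq> {x \<in> topspace X. ?up x \<in> B} \<or> A \<subseteq> {x \<in> topspace X. ?up x \<in> C}"
      using irr closedin_continuous_map_preimage[OF continuous_map_principal_upper B]
        closedin_continuous_map_preimage[OF continuous_map_principal_upper C] by simp
    then show ?thesis using sub[OF B] sub[OF C] by blast
  qed
  ultimately show ?thesis
    unfolding irreducible_closedin_def by simp
qed

lemma quasisober_smyth_lower_bounds: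
  assumes "quasisober (smyth_power_space X)" "irreducible_closedin X A"
  obtains \<D> where "directedin (smyth_power_space X) \<D>" "\<And>K. K \<in> \<D> \<Longrightarrow> K \<inter> A \<noteq> {}"
    "A = Under (specialization X) (\<Inter>\<D>)"
proof -
  let ?P = "smyth_power_space X" and ?up = "\<lambda>x. specialization X `` {x}"
  obtain \<D> where D: "directedin ?P \<D>"
    and cut: "{K \<in> compact_saturated_sets X. K \<inter> A \<noteq> {}} = cut_closure ?P \<D>"
    using assms irreducible_closedin_meeting unfolding quasisober_def by blast
  have closed: "closedin X A" using assms(2) by (simp add: irreducible_closedin_def)
  have DK: "\<D> \<subseteq> compact_saturated_sets X" "\<D> \<noteq> {}"
    using D by (auto simp: directedin_def topspace_smyth_power_space)
  \<comment> \<open>A set lies in its cut closure; here this says that each member of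
    \<open>\<D>\<close> meets A.\<close>
  have "\<D> \<subseteq> cut_closure ?P \<D>"
    using DK by (auto simp: cut_closure_def Under_def Above_def Field_specialization
        topspace_smyth_power_space)
  then have meet: "K \<inter> A \<noteq> {}" if "K \<in> \<D>" for K using that cut by blast
  have meet_iff: "K \<inter> A \<noteq> {} \<longleftrightarrow> \<Inter>\<D> \<subseteq> K" if K: "K \<in> compact_saturated_sets X" for K
  proof -
    \<comment> \<open>Under reverse inclusion, the upper bounds of \<open>\<D>\<close> are the
      compact saturated sets inside \<open>\<Inter>\<D>\<close>.\<close>
    have "K \<inter> A \<noteq> {} \<longleftrightarrow> (\<forall>L\<in>compact_saturated_sets X. L \<subseteq> \<Inter>\<D> \<longrightarrow> L \<subseteq> K)"
    proof -
      have "K \<inter> A \<noteq> {} \<longleftrightarrow> K \<in> cut_closure ?P \<D>" using cut K by blast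
      also have "\<dots> \<longleftrightarrow> (\<forall>L\<in>compact_saturated_sets X. L \<subseteq> \<Inter>\<D> \<longrightarrow> L \<subseteq> K)"
        unfolding cut_closure_def Under_def Above_def Field_specialization
          topspace_smyth_power_space specialization_smyth_power_space
        using K DK(1) by blast
      finally show ?thesis .
    qed
    \<comment> \<open>The intersection is not known to be compact, but it is the union of the
      principal upper sets it contains, and these are compact saturated.\<close>
    also have "\<dots> \<longleftrightarrow> \<Inter>\<D> \<subseteq> K"
    proof (intro iffI subsetI)
      fix x assume L: "\<forall>L\<in>compact_saturated_sets X. L \<subseteq> \<Inter>\<D> \<longrightarrow> L \<subseteq> K" and x: "x \<in> \<Inter>\<D>"
      have xX: "x \<in> topspace X"
      proof -
        obtain K' where "K' \<in> \<D>" using DK(2) by blast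
        then have "K' \<in> compact_saturated_sets X" "x \<in> K'" using DK(1) x by blast+
        then show ?thesis
          by (auto simp: compact_saturated_sets_def dest: compactin_subset_topspace)
      qed
      have "?up x \<subseteq> \<Inter>\<D>"
      proof (rule Inter_greatest)
        fix M assume "M \<in> \<D>"
        then have "M \<in> compact_saturated_sets X" "x \<in> M" using DK(1) x by blast+
        then show "?up x \<subseteq> M" by (rule compact_saturated_principal_upper_subset)
      qed
      then show "x \<in> K"
        using L principal_upper_compact_saturated[OF xX] specialization_refl[OF xX] by blast
    qed blast
    finally show ?thesis .
  qed
  have "a \<in> A \<longleftrightarrow> a \<in> Under (specialization X) (\<Inter>\<D>)" if a: "a \<in> topspace X" for a
  proof -
    \<comment> \<open>A closed set is a lower set, so it contains a as soon as it meets
      \<open>?up a\<close>.\<close>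
    have "a \<in> A \<longleftrightarrow> ?up a \<inter> A \<noteq> {}"
      using specialization_refl[OF a] closedin_specialization_lower[OF closed] by blast
    also have "\<dots> \<longleftrightarrow> \<Inter>\<D> \<subseteq> ?up a"
      by (rule meet_iff[OF principal_upper_compact_saturated[OF a]])
    also have "\<dots> \<longleftrightarrow> a \<in> Under (specialization X) (\<Inter>\<D>)"
      using a by (auto simp: Under_def Field_specialization)
    finally show ?thesis .
  qed
  then have "A = Under (specialization X) (\<Inter>\<D>)"
    using closedin_subset[OF closed] unfolding Under_def Field_specialization by blast
  with D meet that show thesis by blast
qed

text \<open>The directed set found is a singleton: A is the set of points below its greatest
  element.\<close>

lemma quasisober_if_well_filtered:
  assumes "t0_space X" "well_filtered X" "quasisober (smyth_power_space X)"
  shows "quasisober X"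
  unfolding quasisober_def
proof (intro conjI allI impI assms(1))
  fix A assume irr: "irreducible_closedin X A"
  then have closed: "closedin X A" by (simp add: irreducible_closedin_def)
  from quasisober_smyth_lower_bounds[OF assms(3) irr] obtain \<D> where
    D: "directedin (smyth_power_space X) \<D>" "\<And>K. K \<in> \<D> \<Longrightarrow> K \<inter> A \<noteq> {}"
    and low: "A = Under (specialization X) (\<Inter>\<D>)" by blast
  \<comment> \<open>Otherwise the open complement of A would contain the intersection, hence by
    well-filteredness some member of \<open>\<D>\<close>, although every member meets A.\<close>
  have "\<Inter>\<D> \<inter> A \<noteq> {}"
  proof
    assume "\<Inter>\<D> \<inter> A = {}"
    moreover have "\<D> \<noteq> {}" and DK: "\<D> \<subseteq> compact_saturated_sets X"
      using D(1) by (auto simp: directedin_def topspace_smyth_power_space)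
    moreover have KX: "\<forall>K\<in>\<D>. compactin X K \<and> saturatedin X K"
      using DK by (auto simp: compact_saturated_sets_def)
    moreover have "\<forall>K\<in>\<D>. K \<subseteq> topspace X"
      using KX compactin_subset_topspace by blast
    ultimately have "\<Inter>\<D> \<subseteq> topspace X - A" by blast
    moreover have "\<forall>K\<in>\<D>. \<forall>L\<in>\<D>. \<exists>M\<in>\<D>. M \<subseteq> K \<and> M \<subseteq> L"
      using D(1) unfolding directedin_def specialization_smyth_power_space by blast
    moreover have "openin X (topspace X - A)" using closed by blast
    ultimately obtain K where "K \<in> \<D>" "K \<subseteq> topspace X - A"
      using assms(2) \<open>\<D> \<noteq> {}\<close> KX unfolding well_filtered_def by metis
    then show False using D(2) by blast
  qed
  then obtain x where x: "x \<in> \<Inter>\<D>" "x \<in> A" by blast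
  have xX: "x \<in> topspace X" using x closedin_subset[OF closed] by blast
  \<comment> \<open>Each point of A is a lower bound of \<open>\<Inter>\<D>\<close>, which contains
    x.\<close>
  have "(a, x) \<in> specialization X" if "a \<in> A" for a
    using that x(1) unfolding low Under_def by blast
  then have "A = {a \<in> topspace X. (a, x) \<in> specialization X}"
    using closedin_specialization_lower[OF closed x(2)] closedin_subset[OF closed] by blast
  also have "\<dots> = cut_closure X {x}"
    using xX specialization_refl[OF xX] specialization_trans[of _ x X]
    by (auto simp: cut_closure_def Under_def Above_def Field_specialization)
  finally have "A = cut_closure X {x}" .
  moreover have "directedin X {x}"
    using xX specialization_refl by (simp add: directedin_def)
  ultimately show "\<exists>D. directedin X D \<and> A = cut_closure X D" by blast
qed

text \<open>The directed set is A itself. The argument covers an empty \<open>\<Inter>\<D>\<close>,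
  in which case A is the whole space.\<close>

lemma quasisober_if_sup_semilattice:
  assumes "t0_space X" "sup_semilattice_on (topspace X) (specialization X)"
    "quasisober (smyth_power_space X)"
  shows "quasisober X"
  unfolding quasisober_def
proof (intro conjI allI impI assms(1))
  fix A assume irr: "irreducible_closedin X A"
  then have AX: "A \<subseteq> topspace X" and ne: "A \<noteq> {}"
    using closedin_subset unfolding irreducible_closedin_def by blast+
  from quasisober_smyth_lower_bounds[OF assms(3) irr] obtain \<D> where
    low: "A = Under (specialization X) (\<Inter>\<D>)" by blast
  have "\<exists>z\<in>A. (x, z) \<in> specialization X \<and> (y, z) \<in> specialization X"
    if xy: "x \<in> A" "y \<in> A" for x y
  proof -
    have "x \<in> topspace X" "y \<in> topspace X" using xy AX by blast+
    then obtain s where s: "is_sup (specialization X) {x, y} s"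
      using assms(2) unfolding sup_semilattice_on_def by blast
    then have sX: "s \<in> topspace X"
      and ub: "(x, s) \<in> specialization X" "(y, s) \<in> specialization X"
      by (auto simp: is_sup_def Above_def Field_specialization)
    \<comment> \<open>Any such c is an upper bound of x and y, hence lies above their
      supremum.\<close>
    have "(s, c) \<in> specialization X" if "c \<in> \<Inter>\<D>" for c
    proof -
      have "(x, c) \<in> specialization X" "(y, c) \<in> specialization X"
        using xy that unfolding low Under_def by blast+
      then have "c \<in> Above (specialization X) {x, y}"
        by (auto simp: Above_def Field_specialization specialization_iff_open)
      then show ?thesis using s by (simp add: is_sup_def)
    qed
    then have "s \<in> A"
      using sX unfolding low Under_def Field_specialization by blast
    then show ?thesis using ub by blast
  qed
  then have "directedin X A" using AX ne by (simp add: directedin_def)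
  moreover have "A = cut_closure X A"
  proof
    show "A \<subseteq> cut_closure X A"
      using AX by (auto simp: cut_closure_def Under_def Above_def Field_specialization)
    \<comment> \<open>Galois connection: \<open>\<Inter>\<D>\<close> consists of upper bounds of A,
      so a lower bound of all upper bounds of A is one of \<open>\<Inter>\<D>\<close>.\<close>
    show "cut_closure X A \<subseteq> A"
    proof
      fix b assume b: "b \<in> cut_closure X A"
      have "(b, c) \<in> specialization X" if c: "c \<in> \<Inter>\<D>" for c
      proof -
        have "(a, c) \<in> specialization X" if "a \<in> A" for a
          using that c unfolding low Under_def by blast
        \<comment> \<open>Nonemptiness of A puts c into the field of the relation, as
          \<open>Above\<close> demands.\<close>
        then have "c \<in> Above (specialization X) A"
          using ne unfolding Above_def Field_specialization by (auto simp: specialization_iff_open)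
        then show ?thesis using b by (simp add: cut_closure_def Under_def)
      qed
      then show "b \<in> A"
        using b unfolding low by (simp add: cut_closure_def Under_def)
    qed
  qed
  ultimately show "\<exists>D. directedin X D \<and> A = cut_closure X D" by blast
qed

theorem theorem3p17:
  fixes X :: "'a topology"
  assumes "t0_space X"
  shows "(well_filtered X \<longrightarrow> quasisober (smyth_power_space X) \<longrightarrow> quasisober X) \<and>
         (sup_semilattice_on (topspace X) (specialization X) \<longrightarrow>
            quasisober (smyth_power_space X) \<longrightarrow> quasisober X)"
  using assms quasisober_if_well_filtered quasisober_if_sup_semilattice by blast

end
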